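(* Let $d\ge 1$. Suppose $f\in L^1(\mathbb{R}^d)$ is continuous and there are constants $C,\varepsilon>0$ such that $$|f(x)|\le\frac{C}{(1+|x|)^{d+\varepsilon}}\quad\text{for all }x\in\mathbb{R}^d,\qquad |\hat f(\xi)|\le\frac{C}{(1+|\xi|)^{d+\varepsilon}}\quad\text{for all }\xi\in\mathbb{R}^d .$$ Then the periodization of $f$ equals its Fourier series at every point: $$(2\pi)^d\sum_{n\in\mathbb{Z}^d}f(x+2\pi n)=\sum_{j\in\mathbb{Z}^d}\hat f(j)e^{ijx},\qquad x\in\mathbb{R}^d .$$ In particular, taking $x=0$ gives $$(2\pi)^d\sum_{n\in\mathbb{Z}^d}f(2\pi n)=\sum_{j\in\mathbb{Z}^d}\hat f(j).$$
   Context: Functions are complex-valued. The Fourier transform of $f\in L^1(\mathbb{R}^d)$ is $\hat f(\xi)=\int_{\mathbb{R}^d}f(x)e^{-i\xi x}\,dx$, where $\xi x=\xi_1x_1+\cdots+\xi_dx_d$ (and similarly $jx=j_1x_1+\cdots+j_dx_d$). The periodization of $f$ is $\operatorname{Pe}(f)(x)=(2\pi)^d\sum_{n\in\mathbb{Z}^d}f(x+2\pi n)$; its $j$-th Fourier coefficient is $\widehat{\operatorname{Pe}(f)}(j)=\frac{1}{(2\pi)^d}\int_{[-\pi,\pi]^d}\operatorname{Pe}(f)(x)e^{-ijx}\,dx=\hat f(j)$. *)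

theory Defs
  imports "HOL-Analysis.Analysis"
begin

text \<open>
  The dimension \<open>d \<ge> 1\<close> is \<open>CARD('n)\<close> for a finite index type \<open>'n\<close>; the lattice \<open>\<int>\<^sup>d\<close> is the
  type \<open>int ^ 'n\<close>, embedded into \<open>real ^ 'n\<close> by \<open>lattice_point\<close>. The product \<open>\<xi>x\<close> is the inner
  product \<open>\<xi> \<bullet> x\<close> and \<open>|x|\<close> is the Euclidean norm.
\<close>

definition lattice_point :: "int ^ 'n \<Rightarrow> real ^ 'n::finite" where
  "lattice_point n = (\<chi> i. real_of_int (n $ i))"

definition fourier_transform :: "(real ^ 'n \<Rightarrow> complex) \<Rightarrow> real ^ 'n::finite \<Rightarrow> complex" where
  "fourier_transform f \<xi> = (LINT x|lborel. f x * exp (- \<i> * complex_of_real (\<xi> \<bullet> x)))"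

text \<open>
  \<open>infsum\<close> is the unordered sum and is \<open>0\<close> for families that are not summable, so uses of
  \<open>periodization\<close> should be accompanied by a summability claim.
\<close>

definition periodization :: "(real ^ 'n \<Rightarrow> complex) \<Rightarrow> real ^ 'n::finite \<Rightarrow> complex" where
  "periodization f x = complex_of_real (2 * pi) ^ CARD('n) *
     (\<Sum>\<^sub>\<infinity>n\<in>(UNIV :: (int ^ 'n) set). f (x + (2 * pi) *\<^sub>R lattice_point n))"

definition fourier_coeff :: "(real ^ 'n \<Rightarrow> complex) \<Rightarrow> int ^ 'n::finite \<Rightarrow> complex" where
  "fourier_coeff g j = 1 / complex_of_real (2 * pi) ^ CARD('n) *
     (LINT x:cbox (\<chi> i. - pi) (\<chi> i. pi)|lborel.
        g x * exp (- \<i> * complex_of_real (lattice_point j \<bullet> x)))"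

end

theory Submission
  imports Defs
begin

text \<open>
  Put \<open>P x = (2\<pi>)\<^sup>d \<Sum>n. f (x + 2\<pi>n)\<close> and \<open>G x = \<Sum>j. a j e\<^sub>j x\<close>, where \<open>a j\<close> is the Fourier transform of
  \<open>f\<close> at \<open>j\<close> and \<open>e\<^sub>j x = exp (i j\<bullet>x)\<close>.  Both are continuous and \<open>2\<pi>\<close>-periodic, and they have the same
  Fourier coefficients; a continuous periodic function is determined by these, so \<open>P = G\<close>.

  Continuity comes from the decay hypotheses through the M-test: \<open>(1 + |n|)\<close> to the power \<open>-(d + \<epsilon>)\<close>
  is summable over the lattice (\<open>summable_on_lattice_powr\<close>), and translating \<open>f\<close> by a bounded
  vector costs only a constant factor (\<open>decay_translate_bound\<close>).  The same uniform convergence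
  allows both series to be integrated term by term over the cube \<open>[-\<pi>,\<pi>]\<^sup>d\<close>.

  For \<open>P\<close> the \<open>n\<close>-th term is the integral of \<open>f\<close> times a character over the cube translated by
  \<open>2\<pi>n\<close>.  These cubes tile the space, so the terms add up to the Fourier transform of \<open>f\<close>
  (\<open>fourier_coeff_periodization\<close>).  For \<open>G\<close>, the orthogonality of the characters singles out one
  coefficient (\<open>integral_fourier_series_character\<close>).

  Uniqueness (\<open>fourier_uniqueness\<close>) rests on the density of trigonometric polynomials.  A continuous
  periodic function is a continuous function on the torus, viewed as the compact set of vectors in
  \<open>\<complex>\<^sup>d\<close> with unimodular entries, where the Stone--Weierstrass theorem approximates it uniformly by
  polynomials in the real and imaginary parts of the coordinates, that is, by trigonometric
  polynomials.  If all Fourier coefficients of \<open>h\<close> vanish, then \<open>h\<close> is orthogonal to approximations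
  of its own conjugate, so the integral of \<open>|h|\<^sup>2\<close> is zero.
\<close>

section \<open>Summability over the lattice\<close>

lemma summable_on_int_powr:
  assumes "q > 1"
  shows "(\<lambda>k::int. 1 / (1 + \<bar>of_int k\<bar>) powr q :: real) summable_on UNIV"
proof -
  let ?g = "\<lambda>k::int. 1 / (1 + \<bar>of_int k\<bar>) powr q :: real"
  have "summable (\<lambda>n::nat. real (Suc n) powr (- q))"
    using assms by (subst summable_Suc_iff) (simp add: summable_real_powr_iff)
  then have "summable (\<lambda>n::nat. 1 / (1 + real n) powr q)"
    by (simp add: powr_minus_divide add.commute)
  then have nat: "(\<lambda>n::nat. 1 / (1 + real n) powr q) summable_on UNIV"
    by (intro summable_nonneg_imp_summable_on) auto
  have "?g summable_on range int"
    using nat by (subst summable_on_reindex) (auto simp: o_def)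
  moreover have "?g summable_on range (\<lambda>n. - int n)"
    using nat by (subst summable_on_reindex) (auto simp: o_def inj_on_def)
  ultimately have "?g summable_on (range int \<union> range (\<lambda>n. - int n))"
    by (rule summable_on_union)
  also have "range int \<union> range (\<lambda>n. - int n) = UNIV"
    by (auto intro: int_cases2)
  finally show ?thesis .
qed

text \<open>
  A finite set of vectors lies in a box \<open>A\<^sup>d\<close>, over which the sum of the products factors into a
  product of one-dimensional sums.
\<close>

lemma summable_on_vec_prod:
  fixes g :: "'a \<Rightarrow> real"
  assumes "g summable_on UNIV" and nonneg: "\<And>k. g k \<ge> 0"
  shows "(\<lambda>n::'a ^ 'n::finite. \<Prod>i\<in>UNIV. g (n $ i)) summable_on UNIV"
proof (rule nonneg_bdd_above_summable_on)
  show "bdd_above (sum (\<lambda>n::'a ^ 'n. \<Prod>i\<in>UNIV. g (n $ i)) ` {F. F \<subseteq> UNIV \<and> finite F})"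
  proof (rule bdd_aboveI2)
    fix F :: "('a ^ 'n) set" assume "F \<in> {F. F \<subseteq> UNIV \<and> finite F}"
    then have F: "finite F" by simp
    define A where "A = (\<Union>i. (\<lambda>n. n $ i) ` F)"
    have A: "finite A" using F by (simp add: A_def)
    have fin: "finite (UNIV \<rightarrow>\<^sub>E A :: ('n \<Rightarrow> 'a) set)"
      using A by (intro finite_PiE) auto
    have "(\<Sum>n\<in>F. \<Prod>i\<in>UNIV. g (n $ i)) = (\<Sum>v\<in>vec_nth ` F. \<Prod>i\<in>UNIV. g (v i))"
      by (subst sum.reindex) (auto simp: inj_on_def vec_nth_inject)
    also have "\<dots> \<le> (\<Sum>v\<in>UNIV \<rightarrow>\<^sub>E A. \<Prod>i\<in>(UNIV :: 'n set). g (v i))"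
      by (rule sum_mono2[OF fin]) (auto simp: A_def intro!: prod_nonneg nonneg)
    also have "\<dots> = (\<Prod>i\<in>(UNIV :: 'n set). \<Sum>k\<in>A. g k)"
      using A by (subst prod_sum_PiE) auto
    also have "\<dots> \<le> (\<Prod>i\<in>(UNIV :: 'n set). \<Sum>\<^sub>\<infinity>k. g k)"
      using assms A by (intro prod_mono conjI sum_nonneg finite_sum_le_infsum) auto
    finally show "(\<Sum>n\<in>F. \<Prod>i\<in>UNIV. g (n $ i)) \<le> (\<Prod>i\<in>(UNIV :: 'n set). \<Sum>\<^sub>\<infinity>k. g k)" .
  qed
qed (auto intro!: prod_nonneg nonneg)

text \<open>
  Every coordinate is at most the norm, so \<open>(1 + |n|)\<close> to the power \<open>p\<close> dominates the product of
  the \<open>(1 + |n\<^sub>i|)\<close> to the power \<open>p / d\<close>, and \<open>p / d > 1\<close>.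
\<close>

lemma summable_on_lattice_powr:
  assumes "p > real CARD('n::finite)"
  shows "(\<lambda>n::int ^ 'n. 1 / (1 + norm (lattice_point n)) powr p) summable_on UNIV"
proof -
  define q where "q = p / real CARD('n)"
  have "q > 1" using assms by (simp add: q_def field_simps)
  then have "(\<lambda>n::int ^ 'n. \<Prod>i\<in>UNIV. 1 / (1 + \<bar>of_int (n $ i)\<bar>) powr q :: real) summable_on UNIV"
    by (intro summable_on_vec_prod summable_on_int_powr) auto
  then show ?thesis
  proof (rule summable_on_comparison_test)
    fix n :: "int ^ 'n"
    let ?N = "norm (lattice_point n)"
    have "(\<Prod>i\<in>UNIV. (1 + \<bar>of_int (n $ i)\<bar>) powr q) \<le> (\<Prod>i\<in>(UNIV :: 'n set). (1 + ?N) powr q)"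
      using \<open>q > 1\<close> component_le_norm_cart[of "lattice_point n"]
      by (intro prod_mono conjI powr_mono2) (auto simp: lattice_point_def)
    also have "\<dots> = (1 + ?N) powr p"
      by (simp add: powr_power q_def add_nonneg_eq_0_iff)
    finally have le: "(\<Prod>i\<in>UNIV. (1 + \<bar>of_int (n $ i)\<bar> :: real) powr q) \<le> (1 + ?N) powr p" .
    have "0 < (\<Prod>i\<in>UNIV. (1 + \<bar>of_int (n $ i)\<bar> :: real) powr q)"
      by (intro prod_pos) (auto simp: add_pos_nonneg)
    with le have "1 / (1 + ?N) powr p \<le> 1 / (\<Prod>i\<in>UNIV. (1 + \<bar>of_int (n $ i)\<bar>) powr q)"
      by (intro divide_left_mono mult_pos_pos order_less_le_trans[OF _ le]) auto
    then show "1 / (1 + ?N) powr p \<le> (\<Prod>i\<in>UNIV. 1 / (1 + \<bar>of_int (n $ i)\<bar>) powr q)"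
      by (simp add: prod_dividef)
  qed auto
qed

text \<open>
  The reason is \<open>1 + |y| \<le> 1 + |cy| \<le> 1 + B + |x + cy| \<le> (1 + B) (1 + |x + cy|)\<close>.  The bound
  obtained involves \<open>x\<close> only through \<open>B\<close>, so the translates of a decaying function have a common
  majorant on bounded sets.
\<close>

lemma decay_translate_bound:
  fixes x y :: "'a::real_normed_vector"
  assumes "norm x \<le> B" and "c \<ge> 1" and "p \<ge> 0"
  shows "1 / (1 + norm (x + c *\<^sub>R y)) powr p \<le> (1 + B) powr p * (1 / (1 + norm y) powr p)"
proof -
  have "norm y \<le> norm (c *\<^sub>R y)"
    using assms mult_right_mono[of 1 c "norm y"] by simp
  also have "\<dots> \<le> norm (x + c *\<^sub>R y) + B"
    using norm_triangle_ineq4[of "x + c *\<^sub>R y" x] assms by simp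
  finally have "norm y \<le> norm (x + c *\<^sub>R y) + B" .
  moreover have "B \<ge> 0" using assms(1) norm_ge_zero order_trans by blast
  moreover from this have "B * norm (x + c *\<^sub>R y) \<ge> 0" by simp
  ultimately have le: "1 + norm y \<le> (1 + B) * (1 + norm (x + c *\<^sub>R y))"
    unfolding distrib_left distrib_right by linarith
  have pos: "1 + norm y > 0" "1 + norm (x + c *\<^sub>R y) > 0"
    by (auto simp: add_pos_nonneg)
  have "(1 + norm y) powr p \<le> ((1 + B) * (1 + norm (x + c *\<^sub>R y))) powr p"
    using le pos assms by (intro powr_mono2) auto
  also have "\<dots> = (1 + B) powr p * (1 + norm (x + c *\<^sub>R y)) powr p"
    by (rule powr_mult)
  finally show ?thesis
    using pos by (simp add: field_simps)
qed

section \<open>Uniformly convergent series\<close>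

lemma continuous_on_infsum:
  fixes u :: "'i \<Rightarrow> 'a::topological_space \<Rightarrow> 'b::banach"
  assumes "\<And>i. continuous_on S (u i)"
    and "\<And>i x. x \<in> S \<Longrightarrow> norm (u i x) \<le> M i" and "M summable_on UNIV"
  shows "continuous_on S (\<lambda>x. \<Sum>\<^sub>\<infinity>i. u i x)"
  using Weierstrass_m_test_general[of UNIV S u M] assms
  by (intro uniform_limit_theorem[where F = "finite_subsets_at_top UNIV"
        and f = "\<lambda>X x. \<Sum>i\<in>X. u i x"])
    (auto intro!: always_eventually continuous_on_sum)

text \<open>
  The M-test gives uniform convergence along the filter of finite subsets of the index set, and
  integration over a box is continuous under uniform convergence.
\<close>

lemma has_sum_integral_cbox:
  fixes u :: "'i \<Rightarrow> 'a::euclidean_space \<Rightarrow> 'b::banach"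
  assumes cont: "\<And>i. continuous_on (cbox a b) (u i)"
    and bound: "\<And>i x. x \<in> cbox a b \<Longrightarrow> norm (u i x) \<le> M i" and summable: "M summable_on UNIV"
  shows "((\<lambda>i. integral (cbox a b) (u i)) has_sum integral (cbox a b) (\<lambda>x. \<Sum>\<^sub>\<infinity>i. u i x)) UNIV"
proof -
  have "uniform_limit (cbox a b) (\<lambda>X x. \<Sum>i\<in>X. u i x) (\<lambda>x. \<Sum>\<^sub>\<infinity>i. u i x) (finite_subsets_at_top UNIV)"
    using bound summable by (intro Weierstrass_m_test_general) auto
  then obtain I J where I: "\<And>X. ((\<lambda>x. \<Sum>i\<in>X. u i x) has_integral I X) (cbox a b)"
    and J: "((\<lambda>x. \<Sum>\<^sub>\<infinity>i. u i x) has_integral J) (cbox a b)"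
    and lim: "(I \<longlongrightarrow> J) (finite_subsets_at_top UNIV)"
    by (rule uniform_limit_integral_cbox) (auto intro!: continuous_on_sum cont)
  have "(\<Sum>i\<in>X. integral (cbox a b) (u i)) = I X" if "finite X" for X
  proof -
    have "integral (cbox a b) (\<lambda>x. \<Sum>i\<in>X. u i x) = (\<Sum>i\<in>X. integral (cbox a b) (u i))"
      using that cont by (intro integral_sum integrable_continuous) auto
    then show ?thesis using integral_unique[OF I[of X]] by simp
  qed
  then have "((\<lambda>X. \<Sum>i\<in>X. integral (cbox a b) (u i)) \<longlongrightarrow> J) (finite_subsets_at_top UNIV)"
    by (intro Lim_transform_eventually[OF lim])
      (auto simp: eventually_finite_subsets_at_top)
  then show ?thesis
    using J by (simp add: has_sum_def integral_unique)
qed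

section \<open>Characters and their orthogonality\<close>

definition cube :: "(real ^ 'n::finite) set" where
  "cube = cbox (\<chi> i. - pi) (\<chi> i. pi)"

definition character :: "int ^ 'n \<Rightarrow> real ^ 'n::finite \<Rightarrow> complex" where
  "character j x = exp (\<i> * complex_of_real (lattice_point j \<bullet> x))"

lemma lattice_point_0 [simp]: "lattice_point 0 = 0"
  and lattice_point_add: "lattice_point (m + n) = lattice_point m + lattice_point n"
  and lattice_point_uminus: "lattice_point (- n) = - lattice_point n"
  by (simp_all add: lattice_point_def vec_eq_iff)

lemma character_0 [simp]: "character 0 x = 1"
  by (simp add: character_def)

lemma character_at_0 [simp]: "character j 0 = 1"
  by (simp add: character_def)

lemma character_add: "character (j + k) x = character j x * character k x"
  by (simp add: character_def lattice_point_add inner_add_left distrib_left exp_add)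

lemma character_uminus: "character (- j) x = exp (- \<i> * complex_of_real (lattice_point j \<bullet> x))"
  by (simp add: character_def lattice_point_uminus)

lemma norm_character [simp]: "norm (character j x) = 1"
  by (simp add: character_def)

lemma continuous_on_character [continuous_intros]: "continuous_on S (character j)"
  unfolding character_def by (intro continuous_intros)

text \<open>The inner product of two lattice points is an integer.\<close>

lemma character_periodic: "character j (x + (2 * pi) *\<^sub>R lattice_point n) = character j x"
proof -
  have "lattice_point j \<bullet> lattice_point n = of_int (\<Sum>i\<in>UNIV. j $ i * n $ i)"
    by (simp add: inner_vec_def lattice_point_def)
  then obtain m :: int where m: "lattice_point j \<bullet> lattice_point n = of_int m"
    by blast
  have "exp (\<i> * (2 * complex_of_real pi * of_int m)) = 1"
    using exp_integer_2pi[of "of_int m"] by (simp add: algebra_simps)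
  then show ?thesis
    by (simp add: character_def inner_add_right m distrib_left exp_add)
qed

text \<open>
  Lebesgue measure on a Euclidean space is the image of a product of one-dimensional ones, so
  Fubini's theorem separates the variables.  It reduces the orthogonality of characters to
  dimension one.
\<close>

lemma integral_lborel_prod:
  fixes f :: "'a::euclidean_space \<Rightarrow> real \<Rightarrow> complex"
  assumes "\<And>b. b \<in> Basis \<Longrightarrow> integrable lborel (f b)"
  shows "(LINT x|lborel. (\<Prod>b\<in>Basis. f b (x \<bullet> b))) = (\<Prod>b\<in>Basis. LINT t|lborel. f b t)"
proof -
  interpret product_sigma_finite "\<lambda>_::'a. lborel :: real measure"
    by standard
  have meas [measurable]: "f b \<in> borel_measurable borel" if "b \<in> Basis" for b
    using assms[OF that] by simp
  have "(LINT x|lborel. (\<Prod>b\<in>Basis. f b (x \<bullet> b)))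
      = (LINT y|(\<Pi>\<^sub>M b\<in>Basis. lborel). (\<Prod>b\<in>Basis. f b ((\<Sum>c\<in>Basis. y c *\<^sub>R c) \<bullet> (b::'a))))"
    unfolding lborel_eq[where 'a='a] by (rule integral_distr) measurable
  also have "\<dots> = (LINT y|(\<Pi>\<^sub>M b\<in>Basis. lborel). (\<Prod>b\<in>(Basis::'a set). f b (y b)))"
    by simp
  also have "\<dots> = (\<Prod>b\<in>Basis. LINT t|lborel. f b t)"
    by (rule product_integral_prod) (use assms in auto)
  finally show ?thesis .
qed

lemma integral_exp_int_period:
  "(LINT t:{-pi..pi}|lborel. exp (\<i> * complex_of_real (of_int k * t))) =
     (if k = 0 then complex_of_real (2 * pi) else 0)"
proof (cases "k = 0")
  case True
  then show ?thesis by (simp add: set_lebesgue_integral_def scaleR_conv_of_real)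
next
  case False
  let ?e = "\<lambda>t. exp (\<i> * complex_of_real (of_int k * t))"
  have "((\<lambda>z. exp (\<i> * (of_int k * z)) / (\<i> * of_int k)) has_field_derivative exp (\<i> * (of_int k * z))) (at z)" for z
    using False by (auto intro!: derivative_eq_intros simp: mult.left_commute mult.commute)
  from has_vector_derivative_real_field[OF this]
  have "((\<lambda>t. ?e t / (\<i> * of_int k)) has_vector_derivative ?e t) (at t within {-pi..pi})" for t
    by simp
  then have "(?e has_integral (?e pi / (\<i> * of_int k) - ?e (-pi) / (\<i> * of_int k))) {-pi..pi}"
    by (intro fundamental_theorem_of_calculus) auto
  moreover have "?e pi = ?e (-pi)"
    by (rule exp_eq[THEN iffD2], rule exI[of _ k]) (simp add: algebra_simps)
  ultimately have "integral {-pi..pi} ?e = 0"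
    by (simp add: has_integral_iff)
  moreover have "set_integrable lborel {-pi..pi} ?e"
    unfolding set_integrable_def by (intro borel_integrable_compact continuous_intros) auto
  ultimately show ?thesis
    using False by (simp add: set_borel_integral_eq_integral)
qed

lemma cube_iff: "x \<in> cube \<longleftrightarrow> (\<forall>i. - pi \<le> x $ i \<and> x $ i \<le> pi)"
  by (simp add: cube_def mem_box_cart)

lemma set_integrable_cube:
  fixes g :: "real ^ 'n::finite \<Rightarrow> complex"
  assumes "continuous_on cube g"
  shows "set_integrable lborel cube g"
  using assms unfolding set_integrable_def cube_def by (intro borel_integrable_compact) auto

lemma set_lebesgue_integral_cube:
  fixes g :: "real ^ 'n::finite \<Rightarrow> complex"
  assumes "continuous_on cube g"
  shows "(LINT x:cube|lborel. g x) = integral cube g"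
  using set_borel_integral_eq_integral(2)[OF set_integrable_cube[OF assms]] .

text \<open>
  This is the orthogonality relation, since a product of characters is a character.  The integral
  is a product of one-dimensional integrals, one of which vanishes if \<open>k\<close> has a nonzero entry.
\<close>

lemma integral_cube_character:
  "integral cube (character k :: real ^ 'n::finite \<Rightarrow> complex) =
     (if k = 0 then complex_of_real (2 * pi) ^ CARD('n) else 0)"
proof -
  define h where "h = (\<lambda>(b :: real ^ 'n) (t::real).
    indicator {-pi..pi} t *\<^sub>R exp (\<i> * complex_of_real ((lattice_point k \<bullet> b) * t)))"
  have Basis: "(Basis :: (real ^ 'n) set) = range (\<lambda>i. axis i 1)"
    by (auto simp: Basis_vec_def)
  have inj: "inj (\<lambda>i::'n. axis i (1::real))"
    by (auto simp: inj_on_def axis_eq_axis)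
  have lp: "lattice_point k \<bullet> axis i 1 = of_int (k $ i)" for i
    by (simp add: lattice_point_def inner_axis)
  have "integral cube (character k) = (LINT x:cube|lborel. character k x)"
    by (simp add: set_lebesgue_integral_cube continuous_intros)
  also have "\<dots> = (LINT x|lborel. (\<Prod>b\<in>Basis. h b (x \<bullet> b)))"
    unfolding set_lebesgue_integral_def
  proof (rule Bochner_Integration.integral_cong[OF refl])
    fix x :: "real ^ 'n"
    have ind: "indicat_real cube x = (\<Prod>i\<in>UNIV. indicat_real {-pi..pi} (x $ i))"
    proof (cases "x \<in> cube")
      case True
      then show ?thesis by (simp add: cube_iff)
    next
      case False
      then obtain i where "x $ i \<notin> {-pi..pi}" by (auto simp: cube_iff)
      then have "indicat_real {-pi..pi} (x $ i) = 0" by simp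
      then have "(\<Prod>i\<in>UNIV. indicat_real {-pi..pi} (x $ i)) = 0"
        by (intro prod_zero) auto
      then show ?thesis using False by simp
    qed
    have chr: "character k x = (\<Prod>i\<in>UNIV. exp (\<i> * complex_of_real (of_int (k $ i) * x $ i)))"
      by (simp add: character_def inner_vec_def lattice_point_def sum_distrib_left exp_sum)
    have "(\<Prod>b\<in>Basis. h b (x \<bullet> b)) = (\<Prod>i\<in>UNIV. h (axis i 1) (x $ i))"
      unfolding Basis by (subst prod.reindex[OF inj]) (simp add: inner_axis)
    also have "\<dots> = indicator cube x *\<^sub>R character k x"
      unfolding ind chr h_def lp by (simp add: scaleR_conv_of_real prod.distrib)
    finally show "indicator cube x *\<^sub>R character k x = (\<Prod>b\<in>Basis. h b (x \<bullet> b))" ..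
  qed
  also have "\<dots> = (\<Prod>b\<in>Basis. LINT t|lborel. h b t)"
  proof (rule integral_lborel_prod)
    show "integrable lborel (h b)" for b
      unfolding h_def by (intro borel_integrable_compact continuous_intros) auto
  qed
  also have "\<dots> = (\<Prod>i\<in>UNIV. LINT t|lborel. h (axis i 1) t)"
    unfolding Basis by (subst prod.reindex[OF inj]) simp
  also have "\<dots> = (\<Prod>i\<in>UNIV. if k $ i = 0 then complex_of_real (2 * pi) else 0)"
    unfolding h_def lp using integral_exp_int_period unfolding set_lebesgue_integral_def by simp
  also have "\<dots> = (if k = 0 then complex_of_real (2 * pi) ^ CARD('n) else 0)"
  proof (cases "k = 0")
    case False
    then obtain i where "k $ i \<noteq> 0" by (auto simp: vec_eq_iff)
    then show ?thesis using False by (auto intro!: prod_zero)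
  qed simp
  finally show ?thesis .
qed

section \<open>Unfolding an integral over translated cubes\<close>

lemma null_sets_cbox_minus_box: "cbox a b - box a b \<in> null_sets lborel"
proof -
  have "cbox a b - box a b \<in> null_sets (completion lborel)"
    using negligible_frontier_interval[of a b] by (simp add: negligible_iff_null_sets)
  then show ?thesis
    using null_sets_completion_iff[of "cbox a b - box a b" lborel] by auto
qed

text \<open>
  The fibre over \<open>k\<close> of the rounding map \<open>s \<mapsto> \<lfloor>(s + \<pi>) / (2\<pi>)\<rfloor>\<close> is the interval \<open>[-\<pi>,\<pi>)\<close> shifted
  by \<open>2\<pi>k\<close>.  Describing half-open cubes as fibres makes it immediate that they partition the space.
\<close>

lemma floor_cell_iff:
  "\<lfloor>(2 * pi * of_int k + t + pi) / (2 * pi)\<rfloor> = k \<longleftrightarrow> - pi \<le> t \<and> t < pi"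
  by (auto simp: floor_eq_iff field_simps)

text \<open>
  The half-open cells partition the space, and each differs from a closed translated cube only
  by a null set.  Countable additivity of the integral gives the value as a sum along an enumeration
  of the lattice; the assumed unordered sum has the same value along any enumeration.
\<close>

lemma integral_eq_has_sum_translates:
  fixes F :: "real ^ 'n::finite \<Rightarrow> complex"
  assumes int: "integrable lborel F" and cont: "continuous_on UNIV F"
    and S: "((\<lambda>n::int ^ 'n. integral cube (\<lambda>x. F (x + (2 * pi) *\<^sub>R lattice_point n))) has_sum S) UNIV"
  shows "(LINT x|lborel. F x) = S"
proof -
  define cell where "cell n = {x :: real ^ 'n. \<forall>i. \<lfloor>(x $ i + pi) / (2 * pi)\<rfloor> = n $ i}" for n :: "int ^ 'n"
  have [measurable]: "cell n \<in> sets borel" for n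
    unfolding cell_def by measurable
  have cell: "(LINT x:cell n|lborel. F x) = integral cube (\<lambda>x. F (x + (2 * pi) *\<^sub>R lattice_point n))" for n
  proof -
    let ?c = "(2 * pi) *\<^sub>R lattice_point n"
    have [measurable]: "F \<in> borel_measurable borel" using int by simp
    have mem: "?c + x \<in> cell n \<longleftrightarrow> (\<forall>i. - pi \<le> x $ i \<and> x $ i < pi)" for x
      by (simp add: cell_def lattice_point_def floor_cell_iff)
    have "(LINT x:cell n|lborel. F x) = (LINT x|distr lborel borel ((+) ?c). indicator (cell n) x *\<^sub>R F x)"
      by (simp add: lborel_distr_plus set_lebesgue_integral_def)
    also have "\<dots> = (LINT x|lborel. indicator (cell n) (?c + x) *\<^sub>R F (?c + x))"
      by (rule integral_distr) measurable
    also have "\<dots> = (LINT x|lborel. indicator cube x *\<^sub>R F (x + ?c))"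
    proof (rule integral_cong_AE)
      have "AE x in lborel. x \<notin> cbox (\<chi> i. - pi) (\<chi> i. pi) - box (\<chi> i. - pi) (\<chi> i::'n. pi)"
        by (rule AE_not_in[OF null_sets_cbox_minus_box])
      then show "AE x in lborel. indicat_real (cell n) (?c + x) *\<^sub>R F (?c + x) = indicat_real cube x *\<^sub>R F (x + ?c)"
      proof eventually_elim
        fix x :: "real ^ 'n" assume "x \<notin> cbox (\<chi> i. - pi) (\<chi> i. pi) - box (\<chi> i. - pi) (\<chi> i. pi)"
        then have "x \<in> cube \<longleftrightarrow> (\<forall>i. - pi \<le> x $ i \<and> x $ i < pi)"
          unfolding cube_iff by (auto simp: mem_box_cart less_imp_le)
        then show "indicat_real (cell n) (?c + x) *\<^sub>R F (?c + x) = indicat_real cube x *\<^sub>R F (x + ?c)"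
          by (simp only: indicator_def mem add.commute[of x])
      qed
    qed (simp_all add: cube_def)
    also have "\<dots> = integral cube (\<lambda>x. F (x + ?c))"
      by (subst set_lebesgue_integral_cube[symmetric])
        (auto simp: set_lebesgue_integral_def intro!: continuous_on_compose2[OF cont] continuous_intros)
    finally show ?thesis .
  qed
  have "infinite (UNIV :: (int ^ 'n) set)"
  proof
    assume "finite (UNIV :: (int ^ 'n) set)"
    then have "finite (range (\<lambda>k::int. (\<chi> i. k) :: int ^ 'n))" by (rule finite_subset[rotated]) auto
    then have "finite (UNIV :: int set)"
      by (rule finite_imageD) (auto simp: inj_on_def vec_eq_iff)
    then show False using infinite_UNIV_int by simp
  qed
  then have bij: "bij_betw (from_nat_into (UNIV :: (int ^ 'n) set)) UNIV UNIV"
    by (intro bij_betw_from_nat_into) auto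
  let ?e = "from_nat_into (UNIV :: (int ^ 'n) set)"
  have "((\<lambda>n. LINT x:cell n|lborel. F x) has_sum S) UNIV"
    using S by (simp add: cell)
  then have "(\<lambda>m. LINT x:cell (?e m)|lborel. F x) sums S"
    using has_sum_reindex_bij_betw[OF bij, of "\<lambda>n. LINT x:cell n|lborel. F x" S]
    by (intro has_sum_imp_sums) simp
  moreover have "(\<Union>m. cell (?e m)) = UNIV"
  proof -
    have "(\<Union>m. cell (?e m)) = (\<Union>n\<in>range ?e. cell n)" by (simp only: image_image)
    also have "\<dots> = (\<Union>n. cell n)" using bij_betw_imp_surj_on[OF bij] by simp
    also have "x \<in> (\<Union>n. cell n)" for x
      by (rule UN_I[of "\<chi> i. \<lfloor>(x $ i + pi) / (2 * pi)\<rfloor>"]) (simp_all add: cell_def)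
    then have "(\<Union>n. cell n) = UNIV" by blast
    finally show ?thesis .
  qed
  moreover have "cell (?e i) \<inter> cell (?e j) = {}" if "i \<noteq> j" for i j
  proof -
    have "cell m \<inter> cell n = {}" if "m \<noteq> n" for m n
      using that by (auto simp: cell_def vec_eq_iff)
    moreover have "?e i \<noteq> ?e j"
      using bij_betw_imp_inj_on[OF bij] \<open>i \<noteq> j\<close> by (auto dest: injD)
    ultimately show ?thesis by blast
  qed
  ultimately show ?thesis
    using lebesgue_integral_countable_add[of "\<lambda>m. cell (?e m)" lborel F] int
    by (simp add: set_lebesgue_integral_def set_integrable_def sums_iff)
qed

section \<open>Approximation by trigonometric polynomials\<close>

inductive trig_poly :: "(real ^ 'n::finite \<Rightarrow> complex) \<Rightarrow> bool" where
  character: "trig_poly (\<lambda>x. c * character j x)"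
| add: "trig_poly p \<Longrightarrow> trig_poly q \<Longrightarrow> trig_poly (\<lambda>x. p x + q x)"

lemma trig_poly_const: "trig_poly (\<lambda>x. c)"
  using trig_poly.character[of c 0] by simp

lemma trig_poly_sum: "(\<And>i. i \<in> I \<Longrightarrow> trig_poly (p i)) \<Longrightarrow> trig_poly (\<lambda>x. \<Sum>i\<in>I. p i x)"
  by (induction I rule: infinite_finite_induct) (auto intro: trig_poly_const trig_poly.add)

lemma trig_poly_mult:
  assumes "trig_poly p" and "trig_poly q"
  shows "trig_poly (\<lambda>x. p x * q x)"
  using assms
proof (induction p)
  case (character c j)
  from \<open>trig_poly q\<close> show ?case
  proof (induction q)
    case (character d k)
    have "(\<lambda>x. c * character j x * (d * character k x)) = (\<lambda>x. (c * d) * character (j + k) x)"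
      by (simp add: character_add fun_eq_iff)
    then show ?case by (metis trig_poly.character)
  qed (simp add: distrib_left trig_poly.add)
qed (simp add: distrib_right trig_poly.add)

text \<open>
  The torus is embedded in \<open>\<complex>\<^sup>d\<close> so that the coordinate functions of the ambient real vector space
  restrict to the cosines and sines, and polynomials restrict to trigonometric polynomials.
\<close>

definition torus_point :: "real ^ 'n \<Rightarrow> complex ^ 'n::finite" where
  "torus_point x = (\<chi> i. cis (x $ i))"

lemma trig_poly_cos: "trig_poly (\<lambda>x. complex_of_real (cos (x $ i)))"
  and trig_poly_sin: "trig_poly (\<lambda>x. complex_of_real (sin (x $ i)))"
proof -
  have axis: "lattice_point (axis i 1) = axis i 1"
    by (simp add: lattice_point_def axis_def vec_eq_iff)
  have char: "character (axis i 1) x = cis (x $ i)" "character (- axis i 1) x = cis (- (x $ i))" for x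
    by (simp_all add: character_def lattice_point_uminus axis inner_axis' cis_conv_exp)
  have "complex_of_real (cos (x $ i)) = 1/2 * character (axis i 1) x + 1/2 * character (- axis i 1) x"
    and "complex_of_real (sin (x $ i)) = - \<i>/2 * character (axis i 1) x + \<i>/2 * character (- axis i 1) x" for x
    by (simp_all add: char complex_eq_iff)
  then show "trig_poly (\<lambda>x. complex_of_real (cos (x $ i)))" "trig_poly (\<lambda>x. complex_of_real (sin (x $ i)))"
    by (simp_all only: trig_poly.intros)
qed

text \<open>
  A linear functional of the point with coordinates \<open>cos x\<^sub>i + i sin x\<^sub>i\<close> is a linear combination of
  cosines and sines; sums and products stay inside the trigonometric polynomials.
\<close>

lemma trig_poly_real_polynomial:
  assumes "real_polynomial_function p"
  shows "trig_poly (\<lambda>x. complex_of_real (p (torus_point x)))"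
  using assms
proof (induction p)
  case (linear f)
  then interpret bounded_linear f .
  have "torus_point x = (\<Sum>i\<in>UNIV. cos (x $ i) *\<^sub>R axis i 1 + sin (x $ i) *\<^sub>R axis i \<i>)" for x :: "real ^ 'a"
    by (simp add: vec_eq_iff torus_point_def axis_def if_distrib sum.distrib complex_eq_iff cong: if_cong)
  then have "complex_of_real (f (torus_point x)) = (\<Sum>i\<in>UNIV. complex_of_real (cos (x $ i)) * of_real (f (axis i 1)) +
      complex_of_real (sin (x $ i)) * of_real (f (axis i \<i>)))" for x
    by (simp add: sum add scaleR)
  then show ?case
    by (auto intro!: trig_poly_sum trig_poly.add trig_poly_mult trig_poly_cos trig_poly_sin trig_poly_const)
qed (auto intro: trig_poly_const trig_poly.add trig_poly_mult)

lemma trig_poly_polynomial_function: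
  fixes g :: "complex ^ 'n::finite \<Rightarrow> complex"
  assumes "polynomial_function g"
  shows "trig_poly (\<lambda>x. g (torus_point x))"
proof -
  have "real_polynomial_function (Re \<circ> g)" "real_polynomial_function (Im \<circ> g)"
    using assms bounded_linear_Re bounded_linear_Im by (auto simp: polynomial_function_def)
  then have "trig_poly (\<lambda>x. complex_of_real (Re (g (torus_point x))) + \<i> * complex_of_real (Im (g (torus_point x))))"
    by (intro trig_poly.add trig_poly_mult trig_poly_const) (auto dest: trig_poly_real_polynomial)
  then show ?thesis by (simp flip: complex_eq)
qed

lemma torus_point_eqD:
  assumes "torus_point x = torus_point y"
  obtains n where "x = y + (2 * pi) *\<^sub>R lattice_point n"
proof -
  have "\<exists>k::int. x $ i = y $ i + 2 * pi * of_int k" for i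
  proof -
    have "exp (\<i> * complex_of_real (x $ i)) = exp (\<i> * complex_of_real (y $ i))"
      using assms by (simp add: torus_point_def vec_eq_iff cis_conv_exp)
    then obtain k :: int where "\<i> * complex_of_real (x $ i) = \<i> * complex_of_real (y $ i) + of_int (2 * k) * pi * \<i>"
      by (auto simp: exp_eq)
    then have "\<i> * complex_of_real (x $ i) = \<i> * complex_of_real (y $ i + 2 * pi * of_int k)"
      by (simp add: algebra_simps)
    then have "x $ i = y $ i + 2 * pi * of_int k"
      by (metis complex_i_not_zero mult_cancel_left of_real_eq_iff)
    then show ?thesis ..
  qed
  then obtain n where "\<And>i. x $ i = y $ i + 2 * pi * of_int (n i)" by metis
  then have "x = y + (2 * pi) *\<^sub>R lattice_point (\<chi> i. n i)"
    by (simp add: vec_eq_iff lattice_point_def)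
  then show ?thesis by (rule that)
qed

lemma translate_into_cube:
  obtains y n where "y \<in> cube" and "x = y + (2 * pi) *\<^sub>R lattice_point n"
proof -
  define n where "n = (\<chi> i. \<lfloor>(x $ i + pi) / (2 * pi)\<rfloor>)"
  define y where "y = x - (2 * pi) *\<^sub>R lattice_point n"
  have "- pi \<le> y $ i \<and> y $ i \<le> pi" for i
    using floor_cell_iff[of "n $ i" "y $ i"] by (simp add: y_def lattice_point_def n_def)
  then show ?thesis
    by (intro that[of y n]) (auto simp: cube_iff y_def)
qed

lemma continuous_on_torus_point: "continuous_on S torus_point"
  unfolding torus_point_def by (intro continuous_intros)

text \<open>
  A periodic function \<open>h\<close> factors as \<open>H \<circ> torus_point\<close>, since the fibres of \<open>torus_point\<close> are the
  lattice cosets.  The factor \<open>H\<close> is continuous because preimages of closed sets under \<open>H\<close> are images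
  under \<open>torus_point\<close> of compact subsets of the cube.  The theorem of Stone and Weierstrass then
  applies to \<open>H\<close> on the compact torus.
\<close>

lemma trig_poly_approximation:
  fixes h :: "real ^ 'n::finite \<Rightarrow> complex"
  assumes cont: "continuous_on cube h"
    and periodic: "\<And>x n. h (x + (2 * pi) *\<^sub>R lattice_point n) = h x"
    and "e > 0"
  obtains p where "trig_poly p" and "\<And>x. x \<in> cube \<Longrightarrow> norm (h x - p x) < e"
proof -
  define T where "T = torus_point ` (cube :: (real ^ 'n) set)"
  \<comment> \<open>By periodicity the value does not depend on which preimage is chosen.\<close>
  define H where "H z = h (SOME x. torus_point x = z)" for z
  have H: "H (torus_point x) = h x" for x
  proof -
    have "torus_point (SOME y. torus_point y = torus_point x) = torus_point x"
      by (rule someI[of _ x]) simp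
    then obtain n where "(SOME y. torus_point y = torus_point x) = x + (2 * pi) *\<^sub>R lattice_point n"
      by (rule torus_point_eqD)
    then show ?thesis by (simp add: H_def periodic)
  qed
  have "compact (cube :: (real ^ 'n) set)" by (simp add: cube_def)
  have "compact T"
    unfolding T_def by (intro compact_continuous_image continuous_on_torus_point) fact
  have "continuous_on T H"
    unfolding continuous_on_closed_vimage[OF compact_imp_closed[OF \<open>compact T\<close>]]
  proof (intro allI impI)
    fix B :: "complex set" assume "closed B"
    have "H -` B \<inter> T = torus_point ` (h -` B \<inter> cube)"
      by (auto simp: T_def H)
    moreover have "compact (h -` B \<inter> cube)"
      using \<open>compact cube\<close> \<open>closed B\<close> cont
      by (metis compact_imp_closed compact_Int_closed continuous_on_closed_vimage inf_commute inf.left_idem)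
    ultimately show "closed (H -` B \<inter> T)"
      by (metis compact_continuous_image compact_imp_closed continuous_on_torus_point)
  qed
  from Stone_Weierstrass_polynomial_function[OF \<open>compact T\<close> this \<open>e > 0\<close>]
  obtain g where "polynomial_function g" and g: "\<And>z. z \<in> T \<Longrightarrow> norm (H z - g z) < e"
    by blast
  moreover have "norm (h x - g (torus_point x)) < e" if "x \<in> cube" for x
    using g[of "torus_point x"] that by (simp add: T_def H)
  ultimately show ?thesis
    by (intro that[of "\<lambda>x. g (torus_point x)"] trig_poly_polynomial_function)
qed

lemma trig_poly_continuous: "trig_poly p \<Longrightarrow> continuous_on S p"
  by (induction p rule: trig_poly.induct) (auto intro!: continuous_intros)

section \<open>Uniqueness of Fourier coefficients\<close>

text \<open>
  The function is orthogonal to all trigonometric polynomials \<open>p\<close>.  Hence the integral \<open>I\<close> of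
  \<open>h\<close> times its conjugate equals the integral of \<open>h\<close> times (conjugate minus \<open>p\<close>), which is
  arbitrarily small; so the squared modulus integrates to zero, and by continuity it vanishes.
\<close>

lemma fourier_uniqueness:
  fixes h :: "real ^ 'n::finite \<Rightarrow> complex"
  assumes cont: "continuous_on cube h"
    and periodic: "\<And>x n. h (x + (2 * pi) *\<^sub>R lattice_point n) = h x"
    and zero: "\<And>j. integral cube (\<lambda>x. h x * character j x) = 0"
  shows "h x = 0"
proof -
  have compact: "compact (cube :: (real ^ 'n) set)" by (simp add: cube_def)
  have orth: "integral cube (\<lambda>x. h x * p x) = 0" if "trig_poly p" for p
    using that
  proof induction
    case (character c j)
    have "(\<lambda>x. h x * (c * character j x)) = (\<lambda>x. c * (h x * character j x))"
      by (simp add: mult_ac)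
    then show ?case by (simp add: zero)
  next
    case (add p q)
    have "(\<lambda>x. h x * p x) integrable_on cube" "(\<lambda>x. h x * q x) integrable_on cube"
      using add cont unfolding cube_def
      by (intro integrable_continuous continuous_on_mult; simp add: trig_poly_continuous)+
    then show ?case
      using add by (simp add: distrib_left integral_add)
  qed
  obtain B where B: "\<And>x. x \<in> cube \<Longrightarrow> norm (h x) \<le> B" "B > 0"
    using compact_imp_bounded[OF compact_continuous_image[OF cont compact]]
    by (auto simp: bounded_pos)
  define I where "I = integral cube (\<lambda>x. h x * cnj (h x))"
  define K where "K = B * measure lborel (cube :: (real ^ 'n) set)"
  have "norm I \<le> 0 + e" if "e > 0" for e
  proof -
    have "K \<ge> 0" using B by (simp add: K_def)
    \<comment> \<open>The denominator is \<open>K + 1\<close> instead of \<open>K\<close> so that it is visibly positive.\<close>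
    then have d: "e / (K + 1) > 0" using \<open>e > 0\<close> by simp
    have "continuous_on cube (\<lambda>x. cnj (h x))"
      using cont by (intro continuous_intros)
    from trig_poly_approximation[OF this _ d] periodic
    obtain p where p: "trig_poly p" "\<And>x. x \<in> cube \<Longrightarrow> norm (cnj (h x) - p x) < e / (K + 1)"
      by auto
    have int: "(\<lambda>x. h x * cnj (h x)) integrable_on cube" "(\<lambda>x. h x * p x) integrable_on cube"
      using p(1) cont unfolding cube_def
      by (intro integrable_continuous continuous_on_mult; simp add: trig_poly_continuous continuous_on_cnj)+
    have "((\<lambda>x. h x * (cnj (h x) - p x)) has_integral I) cube"
      using has_integral_diff[OF integrable_integral[OF int(1)] integrable_integral[OF int(2)]]
      by (simp add: I_def orth p(1) right_diff_distrib)
    then have "norm I \<le> (B * (e / (K + 1))) * measure lborel (cube :: (real ^ 'n) set)"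
      unfolding cube_def
    proof (rule has_integral_bound[rotated])
      show "norm (h x * (cnj (h x) - p x)) \<le> B * (e / (K + 1))"
        if "x \<in> cbox (\<chi> i. - pi) (\<chi> i. pi)" for x
        using that B p(2)[of x] unfolding norm_mult by (intro mult_mono) (auto simp: cube_def less_imp_le)
    qed (intro mult_nonneg_nonneg less_imp_le B d)
    also have "\<dots> = e * (K / (K + 1))" by (simp add: K_def)
    also have "\<dots> \<le> e"
      using \<open>K \<ge> 0\<close> \<open>e > 0\<close> by (simp add: field_simps)
    finally show ?thesis by simp
  qed
  then have "I = 0" using field_le_epsilon[of "norm I" 0] by simp
  have int2: "continuous_on cube (\<lambda>x. (norm (h x))\<^sup>2)"
    using cont by (intro continuous_intros)
  have "I = complex_of_real (integral cube (\<lambda>x. (norm (h x))\<^sup>2))"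
    unfolding I_def complex_norm_square[symmetric]
    using integral_linear[OF _ bounded_linear_of_real, of "\<lambda>x. (norm (h x))\<^sup>2" cube] int2
    by (simp add: o_def cube_def integrable_continuous)
  then have "integral cube (\<lambda>x. (norm (h x))\<^sup>2) = 0" using \<open>I = 0\<close> by simp
  then have "\<forall>x\<in>cube. (norm (h x))\<^sup>2 = 0"
    using int2 unfolding cube_def
    by (subst (asm) integral_cbox_eq_0_iff) (auto simp: interval_ne_empty_cart)
  then show ?thesis
    by (metis norm_eq_zero periodic translate_into_cube zero_eq_power2)
qed

section \<open>Fourier coefficients of the two sides\<close>

lemma infsum_translates_periodic:
  fixes f :: "real ^ 'n::finite \<Rightarrow> complex"
  shows "(\<Sum>\<^sub>\<infinity>n. f (x + (2 * pi) *\<^sub>R lattice_point m + (2 * pi) *\<^sub>R lattice_point n)) =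
    (\<Sum>\<^sub>\<infinity>n. f (x + (2 * pi) *\<^sub>R lattice_point n))"
proof -
  have "(\<Sum>\<^sub>\<infinity>n. f (x + (2 * pi) *\<^sub>R lattice_point (m + n))) = (\<Sum>\<^sub>\<infinity>n. f (x + (2 * pi) *\<^sub>R lattice_point n))"
    by (rule infsum_reindex_bij_betw) (rule bij_plus)
  then show ?thesis by (simp add: lattice_point_add scaleR_add_right add.assoc)
qed

text \<open>
  The characters are \<open>2\<pi>\<close>-periodic, so multiplying the sum over translates by \<open>e\<^sub>-\<^sub>j\<close> gives the sum
  over translates of the single function \<open>f e\<^sub>-\<^sub>j\<close>, and the sum of the integrals over the cube unfolds
  to an integral over the whole space.  The factors \<open>(2\<pi>)\<^sup>d\<close> in the periodization and in the
  Fourier coefficient cancel.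
\<close>

lemma fourier_coeff_periodization:
  fixes f :: "real ^ 'n::finite \<Rightarrow> complex"
  assumes int: "integrable lborel f" and cont: "continuous_on UNIV f"
    and bound: "\<And>x n. x \<in> cube \<Longrightarrow> norm (f (x + (2 * pi) *\<^sub>R lattice_point n)) \<le> M n"
    and summable: "M summable_on UNIV"
  shows "integral cube (\<lambda>x. (\<Sum>\<^sub>\<infinity>n. f (x + (2 * pi) *\<^sub>R lattice_point n)) * character (- j) x)
      = fourier_transform f (lattice_point j)"
    and "fourier_coeff (periodization f) j = fourier_transform f (lattice_point j)"
proof -
  let ?P = "\<lambda>x. \<Sum>\<^sub>\<infinity>n. f (x + (2 * pi) *\<^sub>R lattice_point n)"
  let ?u = "\<lambda>n x. f (x + (2 * pi) *\<^sub>R lattice_point n) * character (- j) x"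
  have contf: "continuous_on S (\<lambda>x. f (x + c))" for S c
    by (intro continuous_on_compose2[OF cont] continuous_intros) auto
  have "((\<lambda>n. integral cube (?u n)) has_sum integral cube (\<lambda>x. \<Sum>\<^sub>\<infinity>n. ?u n x)) UNIV"
    unfolding cube_def
    by (rule has_sum_integral_cbox[of _ _ _ M])
      (use bound summable in \<open>auto simp: norm_mult cube_def intro!: continuous_intros contf\<close>)
  moreover have "(\<lambda>x. \<Sum>\<^sub>\<infinity>n. ?u n x) = (\<lambda>x. ?P x * character (- j) x)"
    by (simp add: infsum_cmult_left')
  ultimately have "((\<lambda>n. integral cube (?u n)) has_sum integral cube (\<lambda>x. ?P x * character (- j) x)) UNIV"
    by simp
  then have "(LINT x|lborel. f x * character (- j) x) = integral cube (\<lambda>x. ?P x * character (- j) x)"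
  proof (intro integral_eq_has_sum_translates)
    show "integrable lborel (\<lambda>x. f x * character (- j) x)"
    proof (rule Bochner_Integration.integrable_bound[OF int])
      have "character (- j) \<in> borel_measurable borel"
        by (intro borel_measurable_continuous_onI continuous_intros)
      then show "(\<lambda>x. f x * character (- j) x) \<in> borel_measurable lborel"
        using int by simp
    qed (simp add: norm_mult)
  qed (simp_all add: character_periodic continuous_on_mult cont continuous_on_character)
  then show P: "integral cube (\<lambda>x. ?P x * character (- j) x) = fourier_transform f (lattice_point j)"
    by (simp add: fourier_transform_def character_uminus inner_commute)
  have "continuous_on cube ?P"
    by (rule continuous_on_infsum[OF _ bound summable]) (rule contf)
  then have "(LINT x:cube|lborel. ?P x * character (- j) x) = fourier_transform f (lattice_point j)"
    by (simp add: set_lebesgue_integral_cube P continuous_intros)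
  then show "fourier_coeff (periodization f) j = fourier_transform f (lattice_point j)"
    unfolding fourier_coeff_def periodization_def cube_def[symmetric] character_uminus[symmetric] mult.assoc
    by simp
qed

text \<open>Integrating term by term, orthogonality leaves only the term \<open>j = k\<close>.\<close>

lemma integral_fourier_series_character:
  fixes a :: "int ^ 'n::finite \<Rightarrow> complex"
  assumes "(\<lambda>j. norm (a j)) summable_on UNIV"
  shows "integral cube (\<lambda>x. (\<Sum>\<^sub>\<infinity>j. a j * character j x) * character (- k) x) =
    complex_of_real (2 * pi) ^ CARD('n) * a k"
proof -
  have "((\<lambda>j. integral cube (\<lambda>x. a j * character j x * character (- k) x)) has_sum
      integral cube (\<lambda>x. \<Sum>\<^sub>\<infinity>j. a j * character j x * character (- k) x)) UNIV"
    unfolding cube_def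
    by (rule has_sum_integral_cbox[OF _ _ assms]) (auto simp: norm_mult intro!: continuous_intros)
  also have "(\<lambda>x. \<Sum>\<^sub>\<infinity>j. a j * character j x * character (- k) x) =
      (\<lambda>x. (\<Sum>\<^sub>\<infinity>j. a j * character j x) * character (- k) x)"
    by (simp add: infsum_cmult_left')
  also have "(\<lambda>j. integral cube (\<lambda>x. a j * character j x * character (- k) x)) =
      (\<lambda>j. if j = k then complex_of_real (2 * pi) ^ CARD('n) * a k else 0)"
  proof
    fix j
    have "(\<lambda>x. a j * character j x * character (- k) x) = (\<lambda>x. a j * character (j - k) x)"
      by (simp add: mult.assoc flip: character_add)
    then show "integral cube (\<lambda>x. a j * character j x * character (- k) x) =
        (if j = k then complex_of_real (2 * pi) ^ CARD('n) * a k else 0)"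
      by (simp add: integral_cube_character)
  qed
  finally show ?thesis
    using has_sum_finite_neutralI[of "{k}" UNIV "\<lambda>j. if j = k then complex_of_real (2 * pi) ^ CARD('n) * a k else 0"]
    by (auto dest: has_sum_unique)
qed

section \<open>Poisson summation\<close>

theorem theorem23p5:
  fixes f :: "real ^ 'n::finite \<Rightarrow> complex" and C \<epsilon> :: real
  assumes "integrable lborel f"
    and "continuous_on UNIV f"
    and "C > 0" and "\<epsilon> > 0"
    and "\<And>x. norm (f x) \<le> C / (1 + norm x) powr (real CARD('n) + \<epsilon>)"
    and "\<And>\<xi>. norm (fourier_transform f \<xi>) \<le> C / (1 + norm \<xi>) powr (real CARD('n) + \<epsilon>)"
  shows
    "(\<forall>x. (\<lambda>n. f (x + (2 * pi) *\<^sub>R lattice_point n)) summable_on (UNIV :: (int ^ 'n) set)) \<and>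
     (\<forall>x. (\<lambda>j. fourier_transform f (lattice_point j) *
              exp (\<i> * complex_of_real (lattice_point j \<bullet> x)))
           summable_on (UNIV :: (int ^ 'n) set)) \<and>
     (\<forall>x. ((\<lambda>j. fourier_coeff (periodization f) j *
              exp (\<i> * complex_of_real (lattice_point j \<bullet> x)))
           has_sum periodization f x) (UNIV :: (int ^ 'n) set)) \<and>
     (\<forall>x. complex_of_real (2 * pi) ^ CARD('n) *
           (\<Sum>\<^sub>\<infinity>n\<in>(UNIV :: (int ^ 'n) set). f (x + (2 * pi) *\<^sub>R lattice_point n)) =
         (\<Sum>\<^sub>\<infinity>j\<in>(UNIV :: (int ^ 'n) set).
           fourier_transform f (lattice_point j) *
           exp (\<i> * complex_of_real (lattice_point j \<bullet> x)))) \<and>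
     (complex_of_real (2 * pi) ^ CARD('n) *
       (\<Sum>\<^sub>\<infinity>n\<in>(UNIV :: (int ^ 'n) set). f ((2 * pi) *\<^sub>R lattice_point n)) =
     (\<Sum>\<^sub>\<infinity>j\<in>(UNIV :: (int ^ 'n) set). fourier_transform f (lattice_point j)))"
proof -
  define p where "p = real CARD('n) + \<epsilon>"
  define w where "w n = 1 / (1 + norm (lattice_point n)) powr p" for n :: "int ^ 'n"
  have w: "w summable_on UNIV"
    unfolding w_def p_def using assms(4) by (intro summable_on_lattice_powr) simp
  then have Cw: "(\<lambda>n. c * w n) summable_on UNIV" for c
    by (rule summable_on_cmult_right)
  have f_bound: "norm (f (x + (2 * pi) *\<^sub>R lattice_point n)) \<le> C * (1 + B) powr p * w n"
    if "norm x \<le> B" for x n B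
  proof -
    have "C * (1 / (1 + norm (x + (2 * pi) *\<^sub>R lattice_point n)) powr p) \<le> C * ((1 + B) powr p * w n)"
      unfolding w_def using that assms(3,4) pi_gt3
      by (intro mult_left_mono decay_translate_bound) (auto simp: p_def)
    then show ?thesis
      using assms(5)[of "x + (2 * pi) *\<^sub>R lattice_point n"] by (simp add: p_def mult.assoc)
  qed
  let ?P = "\<lambda>x. \<Sum>\<^sub>\<infinity>n. f (x + (2 * pi) *\<^sub>R lattice_point n)"
  let ?a = "\<lambda>j. fourier_transform f (lattice_point j)"
  let ?G = "\<lambda>x. \<Sum>\<^sub>\<infinity>j. ?a j * character j x"
  have f_summable: "(\<lambda>n. f (x + (2 * pi) *\<^sub>R lattice_point n)) summable_on UNIV" for x
    by (rule abs_summable_summable, rule summable_on_comparison_test[OF Cw f_bound[OF order_refl]]) auto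
  have a_bound: "norm (?a j) \<le> C * w j" for j
    using assms(6)[of "lattice_point j"] by (simp add: w_def p_def)
  have a_abs: "(\<lambda>j. norm (?a j)) summable_on UNIV"
    by (rule summable_on_comparison_test[OF Cw a_bound]) auto
  have G_summable: "(\<lambda>j. ?a j * character j x) summable_on UNIV" for x
    by (rule abs_summable_summable) (use a_abs in \<open>simp add: norm_mult\<close>)
  obtain B where B: "\<And>x :: real ^ 'n. x \<in> cube \<Longrightarrow> norm x \<le> B"
    using bounded_cbox unfolding cube_def bounded_iff by blast
  note bound = f_bound[OF B]
  have contP: "continuous_on cube ?P"
    by (rule continuous_on_infsum[OF _ bound Cw])
      (auto intro!: continuous_on_compose2[OF assms(2)] continuous_intros)
  have contG: "continuous_on cube ?G"
    by (rule continuous_on_infsum[OF _ _ a_abs]) (auto intro!: continuous_intros simp: norm_mult)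
  note coeff = fourier_coeff_periodization[OF assms(1,2) bound Cw]
  let ?c = "complex_of_real (2 * pi) ^ CARD('n)"
  have eq: "?c * ?P x = ?G x" for x
  proof -
    have "?c * ?P x - ?G x = 0"
    proof (rule fourier_uniqueness[where h = "\<lambda>x. ?c * ?P x - ?G x"])
      show "continuous_on cube (\<lambda>x. ?c * ?P x - ?G x)"
        using contP contG by (intro continuous_intros)
      show "?c * ?P (x + (2 * pi) *\<^sub>R lattice_point n) - ?G (x + (2 * pi) *\<^sub>R lattice_point n) = ?c * ?P x - ?G x"
        for x n
        by (simp only: infsum_translates_periodic character_periodic)
      show "integral cube (\<lambda>x. (?c * ?P x - ?G x) * character j x) = 0" for j
      proof -
        \<comment> \<open>Pairing with \<open>character j\<close> picks out the Fourier coefficient at \<open>- j\<close>.\<close>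
        have "(\<lambda>x. ?c * (?P x * character j x)) integrable_on cube" "(\<lambda>x. ?G x * character j x) integrable_on cube"
          using contP contG unfolding cube_def
          by (auto intro!: integrable_continuous continuous_intros)
        then have "integral cube (\<lambda>x. ?c * (?P x * character j x) - ?G x * character j x) =
            ?c * integral cube (\<lambda>x. ?P x * character j x) - integral cube (\<lambda>x. ?G x * character j x)"
          by (simp only: integral_diff integral_mult_right)
        also have "\<dots> = 0"
          using coeff(1)[of "- j"] integral_fourier_series_character[OF a_abs, of "- j"] by simp
        finally show ?thesis by (simp add: left_diff_distrib mult.assoc)
      qed
    qed
    then show ?thesis by simp
  qed
  have has_sum: "((\<lambda>j. fourier_coeff (periodization f) j * character j x) has_sum periodization f x) UNIV" for x
    using has_sum_infsum[OF G_summable[of x]] by (simp only: coeff(2) periodization_def eq)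
  have "?c * (\<Sum>\<^sub>\<infinity>n. f ((2 * pi) *\<^sub>R lattice_point n)) = (\<Sum>\<^sub>\<infinity>j. ?a j)"
    using eq[of 0] by simp
  with f_summable G_summable has_sum eq show ?thesis
    unfolding character_def by blast
qed

end
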